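(* Let $\mathbf{X} = \boldsymbol{\Omega}_L \mathbf{Z} \boldsymbol{\Omega}_R^\top$ be a random $p \times q$ matrix following the matrix-valued independent component model (with location center $\boldsymbol{\mu} = \mathbf{0}$), where $\boldsymbol{\Omega}_L \in \mathbb{R}^{p\times p}$ and $\boldsymbol{\Omega}_R \in \mathbb{R}^{q\times q}$ are non-singular. Let $\mathbf{S}_L^{-1/2}$ and $\mathbf{S}_R^{-1/2}$ be any inverse square roots of the matrices $\mathrm{cov}_L(\mathbf{X}) = \frac{1}{q}\mathrm{E}(\mathbf{X}\mathbf{X}^\top)$ and $\mathrm{cov}_R(\mathbf{X}) = \frac{1}{p}\mathrm{E}(\mathbf{X}^\top\mathbf{X})$, respectively. Then $$\mathbf{S}_L^{-1/2}\, \mathbf{X}\, (\mathbf{S}_R^{-1/2})^\top \propto \mathbf{W}_L \mathbf{Z} \mathbf{W}_R^\top$$ for some (non-random) orthogonal matrices $\mathbf{W}_L \in \mathbb{R}^{p\times p}$ and $\mathbf{W}_R \in \mathbb{R}^{q \times q}$, where $\propto$ means equality up to multiplication by a non-random positive constant.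
   Context: Matrix-valued independent component model: $\mathbf{X} = \boldsymbol{\mu} + \boldsymbol{\Omega}_L \mathbf{Z} \boldsymbol{\Omega}_R^\top$ with $\boldsymbol{\mu}\in\mathbb{R}^{p\times q}$, $\boldsymbol{\Omega}_L\in\mathbb{R}^{p\times p}$ and $\boldsymbol{\Omega}_R\in\mathbb{R}^{q\times q}$ non-singular, and $\mathbf{Z}\in\mathbb{R}^{p\times q}$ a random matrix such that (1) the components $z_{kl}$ of $\mathbf{Z}$ are mutually independent with $\mathrm{E}(z_{kl})=0$ and $\mathrm{var}(z_{kl})=1$; (2) at most one row of $\mathbf{Z}$ consists entirely of Gaussian components and at most one column of $\mathbf{Z}$ consists entirely of Gaussian components. An inverse square root of a symmetric positive definite matrix $\mathbf{S}\in\mathbb{R}^{p\times p}$ is any matrix $\mathbf{G}\in\mathbb{R}^{p\times p}$ with $\mathbf{G}\mathbf{S}\mathbf{G}^\top=\mathbf{I}_p$. *)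

theory Defs
  imports "HOL-Probability.Probability"
begin

text \<open>A \<open>p \<times> q\<close> matrix has type \<^typ>\<open>real^'q^'p\<close>, so that \<open>p = CARD('p)\<close> counts rows,
  \<open>q = CARD('q)\<close> counts columns, and \<open>A $ k $ l\<close> is the entry in row \<open>k\<close>, column \<open>l\<close>.\<close>

definition (in prob_space) gaussian :: "('a \<Rightarrow> real) \<Rightarrow> bool" where
  "gaussian Y \<longleftrightarrow>
     (\<exists>m s. 0 < s \<and> distributed M lborel Y (\<lambda>x. ennreal (normal_density m s x)))"

locale matrix_ic_model = prob_space M for M :: "'a measure" +
  fixes \<mu> :: "real^'q^'p"
    and \<Omega>\<^sub>L :: "real^'p^'p"
    and \<Omega>\<^sub>R :: "real^'q^'q"
    and Z :: "'a \<Rightarrow> real^'q^'p"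
    and X :: "'a \<Rightarrow> real^'q^'p"
  assumes invertible_L: "invertible \<Omega>\<^sub>L"
    and invertible_R: "invertible \<Omega>\<^sub>R"
    and indep_Z: "indep_vars (\<lambda>_. borel) (\<lambda>(k, l) \<omega>. Z \<omega> $ k $ l) UNIV"
    and integrable_Z: "\<And>k l. integrable M (\<lambda>\<omega>. Z \<omega> $ k $ l)"
    and expectation_Z: "\<And>k l. expectation (\<lambda>\<omega>. Z \<omega> $ k $ l) = 0"
    and variance_Z: "\<And>k l. variance (\<lambda>\<omega>. Z \<omega> $ k $ l) = 1"
    and gaussian_rows: "card {k. \<forall>l. gaussian (\<lambda>\<omega>. Z \<omega> $ k $ l)} \<le> 1"
    and gaussian_columns: "card {l. \<forall>k. gaussian (\<lambda>\<omega>. Z \<omega> $ k $ l)} \<le> 1"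
    and X_eq: "\<And>\<omega>. \<omega> \<in> space M \<Longrightarrow> X \<omega> = \<mu> + \<Omega>\<^sub>L ** Z \<omega> ** transpose \<Omega>\<^sub>R"

text \<open>The expectations below are Bochner integrals of matrix-valued functions; for integrable
  functions these are the entrywise expectations. In the model all second moments of \<open>X\<close> are
  finite, because an integral equal to \<open>1\<close> (the variance) cannot come from a non-integrable
  function.\<close>

definition cov\<^sub>L :: "'a measure \<Rightarrow> ('a \<Rightarrow> real^'q^'p) \<Rightarrow> real^'p^'p" where
  "cov\<^sub>L M X = (1 / real CARD('q)) *\<^sub>R (LINT \<omega>|M. X \<omega> ** transpose (X \<omega>))"

definition cov\<^sub>R :: "'a measure \<Rightarrow> ('a \<Rightarrow> real^'q^'p) \<Rightarrow> real^'q^'q" where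
  "cov\<^sub>R M X = (1 / real CARD('p)) *\<^sub>R (LINT \<omega>|M. transpose (X \<omega>) ** X \<omega>)"

text \<open>Symmetry and positive definiteness of \<open>S\<close> need not be demanded: \<open>G ** S ** transpose G = mat 1\<close>
  forces \<open>G\<close> to be invertible and hence \<open>S = H ** transpose H\<close> with \<open>H\<close> the inverse of \<open>G\<close>.\<close>

definition inverse_sqrt :: "real^'n^'n \<Rightarrow> real^'n^'n \<Rightarrow> bool" where
  "inverse_sqrt S G \<longleftrightarrow> G ** S ** transpose G = mat 1"

definition proportional_on :: "'a set \<Rightarrow> ('a \<Rightarrow> 'b::real_vector) \<Rightarrow> ('a \<Rightarrow> 'b) \<Rightarrow> bool" where
  "proportional_on A Y Y' \<longleftrightarrow> (\<exists>c>0. \<forall>\<omega>\<in>A. Y \<omega> = c *\<^sub>R Y' \<omega>)"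

end

(* Since Z has uncorrelated entries of variance 1, E(Z B Z^T) = (tr B) I for every B. Hence
   cov_L(X) = a Omega_L Omega_L^T with a = tr(Omega_R^T Omega_R) / q, and G_L cov_L(X) G_L^T = I
   says that sqrt(a) G_L Omega_L is orthogonal. The right-hand side is the same statement for
   the transposed model. *)

theory Submission
  imports Defs
begin

text \<open>A vector is the finite sum of its coordinates embedded by \<open>axis i\<close>, and
  these embeddings are bounded linear. Allowing a Euclidean component type lets the rule apply twice
  to a matrix, first to its rows and then to their entries.\<close>

lemma has_bochner_integral_vec:
  fixes f :: "'a \<Rightarrow> 'b::euclidean_space^'n"
  assumes "\<And>i. has_bochner_integral M (\<lambda>\<omega>. f \<omega> $ i) (v $ i)"
  shows "has_bochner_integral M f v"
proof -
  have expand: "(\<Sum>i\<in>UNIV. axis i (x $ i)) = x" for x :: "'b^'n"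
    by (simp add: vec_eq_iff axis_def)
  have "bounded_linear (axis i :: 'b \<Rightarrow> 'b^'n)" for i
    unfolding linear_conv_bounded_linear[symmetric]
    by (rule linearI) (simp_all add: vec_eq_iff axis_def)
  then have "has_bochner_integral M (\<lambda>\<omega>. axis i (f \<omega> $ i)) (axis i (v $ i))" for i
    by (rule has_bochner_integral_bounded_linear) (rule assms)
  then have "has_bochner_integral M (\<lambda>\<omega>. \<Sum>i\<in>UNIV. axis i (f \<omega> $ i)) (\<Sum>i\<in>UNIV. axis i (v $ i))"
    by (intro has_bochner_integral_sum) auto
  then show ?thesis
    by (simp add: expand)
qed

text \<open>Orthonormality of the entries for the pairing E(xy). \<open>has_bochner_integral\<close>
  records integrability together with the value, and the symmetry between rows and columns lets the
  property pass to the transpose.\<close>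

definition white :: "'a measure \<Rightarrow> ('a \<Rightarrow> real^'q^'p) \<Rightarrow> bool" where
  "white M Z \<longleftrightarrow> (\<forall>i k j l.
     has_bochner_integral M (\<lambda>\<omega>. Z \<omega> $ i $ k * Z \<omega> $ j $ l) (of_bool (i = j \<and> k = l)))"

lemma white_transpose:
  assumes "white M Z"
  shows "white M (\<lambda>\<omega>. transpose (Z \<omega>))"
  using assms by (simp add: white_def transpose_def conj_commute)

text \<open>Equal index pairs give the unit variance of a centred entry; for distinct pairs
  independence factors the expectation into a product of zero means.\<close>

lemma (in matrix_ic_model) white_Z: "white M Z"
  unfolding white_def
proof (intro allI)
  fix i j :: 'p and k l :: 'q
  show "has_bochner_integral M (\<lambda>\<omega>. Z \<omega> $ i $ k * Z \<omega> $ j $ l) (of_bool (i = j \<and> k = l))"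
  proof (cases "(i, k) = (j, l)")
    case True
    have sq: "expectation (\<lambda>\<omega>. Z \<omega> $ i $ k * Z \<omega> $ i $ k) = 1"
      using variance_Z[of i k] by (simp add: expectation_Z power2_eq_square)
    \<comment> \<open>The Bochner integral of a non-integrable function is 0 by convention, so the
      value 1 forces integrability.\<close>
    then have "integrable M (\<lambda>\<omega>. Z \<omega> $ i $ k * Z \<omega> $ i $ k)"
      using not_integrable_integral_eq by fastforce
    with sq True show ?thesis
      by (simp add: has_bochner_integral_iff)
  next
    case False
    let ?Y = "\<lambda>(k, l) \<omega>. Z \<omega> $ k $ l"
    have ind: "indep_vars (\<lambda>_. borel) ?Y {(i, k), (j, l)}"
      by (rule indep_vars_subset[OF indep_Z]) simp
    have int: "integrable M (?Y x)" for x
      by (cases x) (simp add: integrable_Z)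
    have "expectation (\<lambda>\<omega>. \<Prod>x\<in>{(i, k), (j, l)}. ?Y x \<omega>) = (\<Prod>x\<in>{(i, k), (j, l)}. expectation (?Y x))"
      by (rule indep_vars_lebesgue_integral[OF _ ind int]) simp
    moreover have "integrable M (\<lambda>\<omega>. \<Prod>x\<in>{(i, k), (j, l)}. ?Y x \<omega>)"
      by (rule indep_vars_integrable[OF _ ind int]) simp
    \<comment> \<open>Since the index pairs differ, the product over the two-element set really has
      two factors.\<close>
    ultimately show ?thesis
      using False by (simp add: has_bochner_integral_iff expectation_Z)
  qed
qed

text \<open>Entry \<open>(i, j)\<close> expands into the terms \<open>B $ k $ l\<close> times
  \<open>Z $ i $ k * Z $ j $ l\<close>. In expectation only \<open>k = l\<close> survives, and only
  when \<open>i = j\<close>, which leaves the trace on the diagonal.\<close>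

lemma white_quadratic:
  assumes "white M Z"
  shows "has_bochner_integral M (\<lambda>\<omega>. Z \<omega> ** B ** transpose (Z \<omega>)) (mat (trace B))"
proof (intro has_bochner_integral_vec)
  fix i j
  have "has_bochner_integral M
      (\<lambda>\<omega>. \<Sum>l\<in>UNIV. \<Sum>k\<in>UNIV. B $ k $ l * (Z \<omega> $ i $ k * Z \<omega> $ j $ l))
      (\<Sum>l\<in>UNIV. \<Sum>k\<in>UNIV. B $ k $ l * of_bool (i = j \<and> k = l))"
    using assms unfolding white_def
    by (intro has_bochner_integral_sum has_bochner_integral_mult_right) auto
  moreover have "(\<Sum>l\<in>UNIV. \<Sum>k\<in>UNIV. B $ k $ l * of_bool (i = j \<and> k = l)) = mat (trace B) $ i $ j"
    by (simp add: mat_def trace_def)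
  ultimately show "has_bochner_integral M (\<lambda>\<omega>. (Z \<omega> ** B ** transpose (Z \<omega>)) $ i $ j)
      (mat (trace B) $ i $ j)"
    by (simp add: matrix_matrix_mult_def transpose_def sum_distrib_right sum_distrib_left ac_simps)
qed

lemma trace_transpose_mult_nonneg: "0 \<le> trace (transpose R ** (R :: real^'m^'n))"
  unfolding trace_def matrix_matrix_mult_def transpose_def by (auto intro!: sum_nonneg)

lemma mat_eq_scaleR: "mat c = c *\<^sub>R (mat 1 :: real^'n^'n)"
  by (simp add: mat_def vec_eq_iff)

text \<open>With B = \<open>transpose R ** R\<close>, the product of X with its transpose is Z B Z^T
  conjugated by \<open>L\<close>. Conjugation is bounded linear, so it commutes with the
  expectation, and the remaining scalar matrix can be pulled out.\<close>

lemma cov\<^sub>L_white: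
  fixes L :: "real^'p^'p" and R :: "real^'q^'q" and Z X :: "'a \<Rightarrow> real^'q^'p"
  assumes "white M Z"
    and X: "\<And>\<omega>. \<omega> \<in> space M \<Longrightarrow> X \<omega> = L ** Z \<omega> ** transpose R"
  shows "cov\<^sub>L M X = (trace (transpose R ** R) / real CARD('q)) *\<^sub>R (L ** transpose L)"
proof -
  let ?B = "transpose R ** R"
  have lin: "bounded_linear (\<lambda>A. L ** A ** transpose L)"
    unfolding linear_conv_bounded_linear[symmetric]
    by (rule linearI)
      (simp_all add: matrix_matrix_mult_def vec_eq_iff algebra_simps sum.distrib sum_distrib_left)
  have "(LINT \<omega>|M. X \<omega> ** transpose (X \<omega>))
      = (LINT \<omega>|M. L ** (Z \<omega> ** ?B ** transpose (Z \<omega>)) ** transpose L)"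
    by (rule Bochner_Integration.integral_cong[OF refl])
      (simp add: X matrix_transpose_mul matrix_mul_assoc)
  also have "\<dots> = L ** mat (trace ?B) ** transpose L"
    by (rule has_bochner_integral_integral_eq
        [OF has_bochner_integral_bounded_linear[OF lin white_quadratic[OF assms(1)]]])
  finally show ?thesis
    by (simp add: cov\<^sub>L_def mat_eq_scaleR[of "trace ?B"] scalar_matrix_assoc[symmetric] matrix_scalar_ac)
qed

lemma inverse_sqrt_orthogonal:
  fixes L G :: "real^'n^'n"
  assumes "inverse_sqrt (a *\<^sub>R (L ** transpose L)) G" and "0 \<le> a"
  shows "0 < a" and "orthogonal_matrix (sqrt a *\<^sub>R (G ** L))"
proof -
  have eq: "a *\<^sub>R (G ** L ** transpose (G ** L)) = mat 1"
    using assms(1) by (simp add: inverse_sqrt_def scalar_matrix_assoc[symmetric] matrix_scalar_ac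
        matrix_transpose_mul matrix_mul_assoc)
  \<comment> \<open>The case \<open>a = 0\<close> would turn \<open>eq\<close> into the false
    equation of the zero and identity matrices.\<close>
  have "(mat 1 :: real^'n^'n) \<noteq> 0"
    by (simp add: mat_def vec_eq_iff)
  with eq have "a \<noteq> 0"
    by auto
  with assms(2) show "0 < a"
    by simp
  have "(sqrt a *\<^sub>R (G ** L)) ** transpose (sqrt a *\<^sub>R (G ** L)) = mat 1"
    using eq assms(2) by (simp add: scalar_matrix_assoc[symmetric] matrix_scalar_ac transpose_scalar)
  \<comment> \<open>For square matrices a right inverse is also a left inverse.\<close>
  then show "orthogonal_matrix (sqrt a *\<^sub>R (G ** L))"
    using matrix_left_right_inverse by (auto simp: orthogonal_matrix_def)
qed

text \<open>One side of the argument, stated for any white matrix so that it serves both X and its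
  transpose, with the two dimensions exchanged. The constant is the square root of the trace factor;
  later only its positivity matters.\<close>

lemma white_inverse_sqrt_orthogonal:
  fixes L G :: "real^'p^'p" and R :: "real^'q^'q" and Z X :: "'a \<Rightarrow> real^'q^'p"
  assumes "white M Z"
    and "\<And>\<omega>. \<omega> \<in> space M \<Longrightarrow> X \<omega> = L ** Z \<omega> ** transpose R"
    and "inverse_sqrt (cov\<^sub>L M X) G"
  obtains c where "0 < c" and "orthogonal_matrix (c *\<^sub>R (G ** L))"
proof -
  let ?a = "trace (transpose R ** R) / real CARD('q)"
  have inv: "inverse_sqrt (?a *\<^sub>R (L ** transpose L)) G"
    using assms(3) by (simp add: cov\<^sub>L_white[OF assms(1,2)])
  have "0 \<le> ?a"
    by (simp add: trace_transpose_mult_nonneg)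
  from inverse_sqrt_orthogonal[OF inv this] show ?thesis
    by (intro that[of "sqrt ?a"]) simp_all
qed

theorem theorem4p2p1:
  fixes M :: "'a measure"
    and \<Omega>\<^sub>L :: "real^'p^'p"
    and \<Omega>\<^sub>R :: "real^'q^'q"
    and Z X :: "'a \<Rightarrow> real^'q^'p"
    and G\<^sub>L :: "real^'p^'p"
    and G\<^sub>R :: "real^'q^'q"
  assumes "matrix_ic_model M 0 \<Omega>\<^sub>L \<Omega>\<^sub>R Z X"
    and "inverse_sqrt (cov\<^sub>L M X) G\<^sub>L"
    and "inverse_sqrt (cov\<^sub>R M X) G\<^sub>R"
  shows "\<exists>(W\<^sub>L :: real^'p^'p) (W\<^sub>R :: real^'q^'q).
           orthogonal_matrix W\<^sub>L \<and> orthogonal_matrix W\<^sub>R \<and>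
           proportional_on (space M)
             (\<lambda>\<omega>. G\<^sub>L ** X \<omega> ** transpose G\<^sub>R)
             (\<lambda>\<omega>. W\<^sub>L ** Z \<omega> ** transpose W\<^sub>R)"
proof -
  interpret matrix_ic_model M 0 \<Omega>\<^sub>L \<Omega>\<^sub>R Z X
    by fact
  have X: "X \<omega> = \<Omega>\<^sub>L ** Z \<omega> ** transpose \<Omega>\<^sub>R" if "\<omega> \<in> space M" for \<omega>
    using X_eq[OF that] by simp
  obtain c where c: "0 < c" "orthogonal_matrix (c *\<^sub>R (G\<^sub>L ** \<Omega>\<^sub>L))"
    using white_inverse_sqrt_orthogonal[OF white_Z X assms(2)] .
  have XT: "transpose (X \<omega>) = \<Omega>\<^sub>R ** transpose (Z \<omega>) ** transpose \<Omega>\<^sub>L" if "\<omega> \<in> space M" for \<omega>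
    by (simp add: X[OF that] matrix_transpose_mul matrix_mul_assoc)
  \<comment> \<open>Transposing twice gives X back, so the right covariance of X is the left
    covariance of its transpose.\<close>
  have "inverse_sqrt (cov\<^sub>L M (\<lambda>\<omega>. transpose (X \<omega>))) G\<^sub>R"
    using assms(3) by (simp add: cov\<^sub>L_def cov\<^sub>R_def)
  then obtain d where d: "0 < d" "orthogonal_matrix (d *\<^sub>R (G\<^sub>R ** \<Omega>\<^sub>R))"
    using white_inverse_sqrt_orthogonal[OF white_transpose[OF white_Z] XT] by blast
  \<comment> \<open>The left-hand side is \<open>G\<^sub>L ** \<Omega>\<^sub>L\<close> times Z times
    the transpose of \<open>G\<^sub>R ** \<Omega>\<^sub>R\<close>; scaling the outer factors by
    \<open>c\<close> and \<open>d\<close> to make them orthogonal is compensated by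
    \<open>1 / (c * d)\<close>.\<close>
  have "G\<^sub>L ** X \<omega> ** transpose G\<^sub>R = (1 / (c * d)) *\<^sub>R
      ((c *\<^sub>R (G\<^sub>L ** \<Omega>\<^sub>L)) ** Z \<omega> ** transpose (d *\<^sub>R (G\<^sub>R ** \<Omega>\<^sub>R)))" if "\<omega> \<in> space M" for \<omega>
    using c(1) d(1) by (simp add: X[OF that] scalar_matrix_assoc[symmetric] matrix_scalar_ac
        transpose_scalar matrix_transpose_mul matrix_mul_assoc)
  then have "proportional_on (space M) (\<lambda>\<omega>. G\<^sub>L ** X \<omega> ** transpose G\<^sub>R)
      (\<lambda>\<omega>. (c *\<^sub>R (G\<^sub>L ** \<Omega>\<^sub>L)) ** Z \<omega> ** transpose (d *\<^sub>R (G\<^sub>R ** \<Omega>\<^sub>R)))"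
    using c(1) d(1) unfolding proportional_on_def
    by (intro exI[of _ "1 / (c * d)"]) simp
  with c(2) d(2) show ?thesis
    by blast
qed

end
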